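(* Let $(P_t)_{t\ge0}$ be a Markov transition semi-group on $\mathbb R^d$ with unique invariant distribution $\nu$. Assume that: (i) there exist a Borel function $\Psi:\mathbb R^d\times\mathbb R^d\to\mathbb R_+$ and $e\in\mathbb L^1([0,+\infty))$ (with values in $[0,+\infty)$) such that $$\forall\,t\ge0,\ \forall\,x,x'\in\mathbb R^d,\quad\mathcal W_1(P_t(x,dy),P_t(x',dy))\le\Psi(x,x')\,e(t);$$ (ii) the function $\psi:=\int_{\mathbb R^d}\Psi(\cdot,x')\,\nu(dx')$ is finite and, for some $q>1$ and some $\mu_0\in\mathcal P_q(\mathbb R^d)$, $\ \sup_{t\ge0}\mu_0P_t(\psi^q+|\cdot|^q)<+\infty$. Then $\int|\xi|^q\nu(d\xi)<+\infty$ and $$\forall\,t\ge0,\ \forall\,x\in\mathbb R^d,\quad\mathcal W_1(P_t(x,dy),\nu)\le\psi(x)\,e(t)\qquad\text{together with}\qquad\sup_{t\ge0}\mu_0P_t(\psi^q+|\cdot|^q)<+\infty.$$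
   Context: $\mathcal P_q(\mathbb R^d)$: Borel probability measures on $\mathbb R^d$ with finite $q$-th moment; $|\cdot|$ is the Euclidean norm; $\mathcal W_1(\mu,\nu)=\inf_\varpi\int|x-y|\varpi(dx,dy)$ over couplings $\varpi$ of $\mu$ and $\nu$. *)

theory Defs
  imports "HOL-Probability.Probability"
begin

definition finite_moment_measures :: "real \<Rightarrow> 'a::euclidean_space measure set" where
  "finite_moment_measures q =
     {\<mu> \<in> space (prob_algebra borel). (\<integral>\<^sup>+x. ennreal (norm x powr q) \<partial>\<mu>) < \<infinity>}"

definition couplings :: "'a::euclidean_space measure \<Rightarrow> 'a measure \<Rightarrow> ('a \<times> 'a) measure set" where
  "couplings \<mu> \<nu> =
     {\<pi> \<in> space (prob_algebra (borel \<Otimes>\<^sub>M borel)). distr \<pi> borel fst = \<mu> \<and> distr \<pi> borel snd = \<nu>}"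

text \<open>Extended-valued, so that it is meaningful without any moment condition on the marginals.\<close>
definition W1 :: "'a::euclidean_space measure \<Rightarrow> 'a measure \<Rightarrow> ennreal" where
  "W1 \<mu> \<nu> = (INF \<pi>\<in>couplings \<mu> \<nu>. \<integral>\<^sup>+z. ennreal (norm (fst z - snd z)) \<partial>\<pi>)"

text \<open>
  \<open>P t x\<close> is the measure \<open>P\<^sub>t(x, dy)\<close>; only times \<open>t \<ge> 0\<close> are constrained. For a
  measure \<open>\<mu>\<close>, the measure \<open>\<mu>P\<^sub>t\<close> is the monadic bind of \<open>\<mu>\<close> with \<open>P t\<close>.
\<close>
definition markov_semigroup :: "(real \<Rightarrow> 'a::euclidean_space \<Rightarrow> 'a measure) \<Rightarrow> bool" where
  "markov_semigroup P \<longleftrightarrow>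
     (\<forall>t\<ge>0. P t \<in> borel \<rightarrow>\<^sub>M prob_algebra borel) \<and>
     (\<forall>x. P 0 x = return borel x) \<and>
     (\<forall>s\<ge>0. \<forall>t\<ge>0. \<forall>x. P (s + t) x = P s x \<bind> P t)"

definition invariant_distribution ::
    "(real \<Rightarrow> 'a::euclidean_space \<Rightarrow> 'a measure) \<Rightarrow> 'a measure \<Rightarrow> bool" where
  "invariant_distribution P \<nu> \<longleftrightarrow>
     \<nu> \<in> space (prob_algebra borel) \<and> (\<forall>t\<ge>0. \<nu> \<bind> P t = \<nu>)"

end

theory Submission
  imports Defs
begin

text \<open>
  The contraction estimate is integrated against \<open>\<nu>\<close>. Since \<open>\<nu> = \<nu>P\<^sub>t\<close> is the \<open>\<nu>\<close>-mixture of the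
  measures \<open>P\<^sub>t(x', dy)\<close>, convexity of \<open>W1\<close> in its second argument gives
  \<open>W1(P\<^sub>t(x, dy), \<nu>) \<le> \<integral> W1(P\<^sub>t(x, dy), P\<^sub>t(x', dy)) \<nu>(dx') \<le> \<psi>(x) e(t)\<close>. Two points need an argument:
  the moment of \<open>\<nu>\<close>, and convexity for a continuous mixture.

  For the moment of \<open>\<nu>\<close>, fix a time \<open>t\<close>. For a Lipschitz function \<open>f \<ge> 0\<close> with constant \<open>L\<close>, the easy half of Kantorovich
  duality (\<open>nn_integral_le_W1\<close>) bounds \<open>P\<^sub>t f(x')\<close> by \<open>P\<^sub>t f(x) + L \<Psi>(x, x') e(t)\<close>; averaging over
  \<open>x' \<sim> \<nu>\<close> and \<open>x \<sim> \<mu>0\<close> yields \<open>\<nu>(f) \<le> \<mu>0P\<^sub>t(f) + L \<mu>0(\<psi>) e(t)\<close>. An integrable \<open>e \<ge> 0\<close> takes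
  arbitrarily small values, and \<open>\<mu>0(\<psi>)\<close> is finite because \<open>\<psi> \<le> 1 + \<psi>\<^sup>q\<close>. So \<open>\<nu>(f)\<close> is at most
  \<open>sup\<^sub>t \<mu>0P\<^sub>t(|\<cdot>|\<^sup>q)\<close> for every truncation \<open>f = min(|\<cdot>|, n)\<^sup>q\<close>; let \<open>n\<close> tend to infinity
  (\<open>invariant_moment_le\<close>).

  The obvious proof of convexity (\<open>W1_bind_le\<close>) chooses a nearly optimal coupling of \<open>\<mu>\<close> and \<open>K(x)\<close>
  measurably in \<open>x\<close>, which calls for a measurable selection theorem. Quantisation replaces it.
  Let \<open>\<nu> = \<integral> K(x) N(dx)\<close> have a first moment, and choose a map \<open>T\<close> with finite range and
  \<open>\<integral> |y - T y| \<nu>(dy)\<close> small. Partition the parameter space into finitely many cells on each of which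
  the image measure of \<open>K(x)\<close> under \<open>T\<close> is almost constant, and replace every \<open>x\<close> by a representative
  \<open>r(x)\<close> of its cell that nearly minimises the sum of the transport cost and the quantisation
  error of \<open>K(x)\<close>. The mixture \<open>\<nu>'\<close> of the \<open>K(r(x))\<close> has only
  finitely many components, so couplings can be mixed by hand (\<open>W1_bind_countable\<close>). The measures
  \<open>\<nu>'\<close> and \<open>\<nu>\<close> give almost the same mass to each cell of \<open>T\<close>, so an explicit maximal coupling of
  their images under \<open>T\<close> lifts to a cheap coupling of \<open>\<nu>'\<close> and \<open>\<nu>\<close> with a density with respect to
  \<open>\<nu>' \<otimes> \<nu>\<close> (\<open>quantised_coupling_density\<close>). Thanks to that density it can be glued to a coupling of \<open>\<mu>\<close>
  and \<open>\<nu>'\<close> without disintegration (\<open>W1_triangle_density\<close>).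
\<close>

section \<open>Couplings and the Wasserstein distance\<close>

lemma couplingsD:
  assumes "\<pi> \<in> couplings \<mu> \<nu>"
  shows "sets \<pi> = sets (borel \<Otimes>\<^sub>M borel)" "prob_space \<pi>"
    "distr \<pi> borel fst = \<mu>" "distr \<pi> borel snd = \<nu>"
  using assms by (auto simp: couplings_def space_prob_algebra)

lemma couplings_nn_integral:
  assumes "\<pi> \<in> couplings \<mu> \<nu>" and [measurable]: "f \<in> borel_measurable borel"
  shows "(\<integral>\<^sup>+w. f (fst w) \<partial>\<pi>) = (\<integral>\<^sup>+x. f x \<partial>\<mu>)" "(\<integral>\<^sup>+w. f (snd w) \<partial>\<pi>) = (\<integral>\<^sup>+y. f y \<partial>\<nu>)"
proof -
  note [measurable_cong] = couplingsD(1)[OF assms(1)]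
  show "(\<integral>\<^sup>+w. f (fst w) \<partial>\<pi>) = (\<integral>\<^sup>+x. f x \<partial>\<mu>)"
    unfolding couplingsD(3)[OF assms(1), symmetric] by (subst nn_integral_distr) auto
  show "(\<integral>\<^sup>+w. f (snd w) \<partial>\<pi>) = (\<integral>\<^sup>+y. f y \<partial>\<nu>)"
    unfolding couplingsD(4)[OF assms(1), symmetric] by (subst nn_integral_distr) auto
qed

lemma W1_lessE:
  assumes "W1 \<mu> \<nu> < c"
  obtains \<pi> where "\<pi> \<in> couplings \<mu> \<nu>" "(\<integral>\<^sup>+z. ennreal (norm (fst z - snd z)) \<partial>\<pi>) < c"
  using assms unfolding W1_def by (auto simp: INF_less_iff)

lemma W1_le_cost:
  assumes "\<pi> \<in> couplings \<mu> \<nu>"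
  shows "W1 \<mu> \<nu> \<le> (\<integral>\<^sup>+z. ennreal (norm (fst z - snd z)) \<partial>\<pi>)"
  unfolding W1_def by (rule INF_lower[OF assms])

text \<open>
  The easy half of Kantorovich duality: integrate the Lipschitz bound over a coupling. An upper bound
  \<open>c\<close> that is strictly larger than the distance supplies one without any discussion of optimal
  couplings, and it keeps the case of an infinite distance out of the statement.
\<close>

lemma nn_integral_le_W1:
  fixes f :: "'a::euclidean_space \<Rightarrow> ennreal" and L :: ennreal
  assumes [measurable]: "f \<in> borel_measurable borel"
    and lip: "\<And>x y. f y \<le> f x + L * ennreal (norm (x - y))"
    and "W1 \<mu> \<nu> < c"
  shows "(\<integral>\<^sup>+y. f y \<partial>\<nu>) \<le> (\<integral>\<^sup>+x. f x \<partial>\<mu>) + L * c"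
proof -
  obtain \<pi> where \<pi>: "\<pi> \<in> couplings \<mu> \<nu>" "(\<integral>\<^sup>+z. ennreal (norm (fst z - snd z)) \<partial>\<pi>) < c"
    using W1_lessE[OF assms(3)] .
  note [measurable_cong] = couplingsD(1)[OF \<pi>(1)]
  have "(\<integral>\<^sup>+y. f y \<partial>\<nu>) = (\<integral>\<^sup>+w. f (snd w) \<partial>\<pi>)"
    by (simp add: couplings_nn_integral[OF \<pi>(1)])
  also have "\<dots> \<le> (\<integral>\<^sup>+w. f (fst w) + L * ennreal (norm (fst w - snd w)) \<partial>\<pi>)"
    by (intro nn_integral_mono lip)
  also have "\<dots> = (\<integral>\<^sup>+x. f x \<partial>\<mu>) + L * (\<integral>\<^sup>+w. ennreal (norm (fst w - snd w)) \<partial>\<pi>)"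
    by (simp add: nn_integral_add nn_integral_cmult couplings_nn_integral[OF \<pi>(1)])
  also have "\<dots> \<le> (\<integral>\<^sup>+x. f x \<partial>\<mu>) + L * c"
    using \<pi>(2) by (intro add_left_mono mult_left_mono) auto
  finally show ?thesis .
qed

text \<open>
  A triangle inequality in which the coupling of \<open>\<nu>'\<close> and \<open>\<nu>\<close> is the measure with density \<open>k\<close> with respect
  to \<open>\<nu>' \<Otimes>\<^sub>M \<nu>\<close>. Its conditional law given \<open>y\<close> is then \<open>k(y, z) \<nu>(dz)\<close>, so the glued law of the triple is
  \<open>k(y, z) \<pi>(dx, dy) \<nu>(dz)\<close>, and no disintegration is needed. The first marginal condition
  makes the pair \<open>(x, y)\<close> have law \<open>\<pi>\<close>, the second one makes \<open>z\<close> have law \<open>\<nu>\<close>.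
\<close>

lemma W1_triangle_density:
  fixes \<mu> \<nu> \<nu>' :: "'a::euclidean_space measure" and k :: "'a \<times> 'a \<Rightarrow> ennreal"
  assumes \<pi>: "\<pi> \<in> couplings \<mu> \<nu>'" and \<nu>: "\<nu> \<in> space (prob_algebra borel)"
    and k[measurable]: "k \<in> borel_measurable (borel \<Otimes>\<^sub>M borel)"
    and k1: "AE y in \<nu>'. (\<integral>\<^sup>+z. k (y, z) \<partial>\<nu>) = 1"
    and k2: "AE z in \<nu>. (\<integral>\<^sup>+y. k (y, z) \<partial>\<nu>') = 1"
  shows "W1 \<mu> \<nu> \<le> (\<integral>\<^sup>+w. ennreal (norm (fst w - snd w)) \<partial>\<pi>)
           + (\<integral>\<^sup>+y. (\<integral>\<^sup>+z. ennreal (norm (y - z)) * k (y, z) \<partial>\<nu>) \<partial>\<nu>')"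
proof -
  have sp[measurable_cong]: "sets \<pi> = sets (borel \<Otimes>\<^sub>M borel)"
    by (rule couplingsD[OF \<pi>])
  have sn[measurable_cong]: "sets \<nu> = sets borel" and pn: "prob_space \<nu>"
    using \<nu> by (auto simp: space_prob_algebra)
  have sn'[measurable_cong]: "sets \<nu>' = sets borel"
    using couplingsD(4)[OF \<pi>] by auto
  interpret P: prob_space \<pi> by (rule couplingsD[OF \<pi>])
  interpret N: prob_space \<nu> by (rule pn)
  interpret N': prob_space \<nu>'
    using P.prob_space_distr[of snd borel] couplingsD(4)[OF \<pi>] by simp
  \<comment> \<open>\<open>M\<close> is the glued law of \<open>((x, y), z)\<close>, and \<open>\<rho>\<close> forgets \<open>y\<close>.\<close>
  define M where "M = density (\<pi> \<Otimes>\<^sub>M \<nu>) (\<lambda>p. k (snd (fst p), snd p))"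
  define \<rho> where "\<rho> = distr M (borel \<Otimes>\<^sub>M borel) (\<lambda>p. (fst (fst p), snd p))"
  have sM[measurable_cong]: "sets M = sets ((borel \<Otimes>\<^sub>M borel) \<Otimes>\<^sub>M borel)"
    unfolding M_def by (simp add: sp sn cong: sets_pair_measure_cong)
  have M_int: "(\<integral>\<^sup>+p. f p \<partial>M) = (\<integral>\<^sup>+w. (\<integral>\<^sup>+z. k (snd w, z) * f (w, z) \<partial>\<nu>) \<partial>\<pi>)"
    if [measurable]: "f \<in> borel_measurable ((borel \<Otimes>\<^sub>M borel) \<Otimes>\<^sub>M borel)" for f
    unfolding M_def
    by (subst nn_integral_density) (auto simp: N.nn_integral_fst[symmetric])
  have AE_k1: "AE w in \<pi>. (\<integral>\<^sup>+z. k (snd w, z) \<partial>\<nu>) = 1"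
    using k1 unfolding couplingsD(4)[OF \<pi>, symmetric]
    by (subst (asm) AE_distr_iff) auto
  have M_fst: "(\<integral>\<^sup>+p. f (fst p) \<partial>M) = (\<integral>\<^sup>+w. f w \<partial>\<pi>)"
    if [measurable]: "f \<in> borel_measurable (borel \<Otimes>\<^sub>M borel)" for f
  proof -
    have "(\<integral>\<^sup>+p. f (fst p) \<partial>M) = (\<integral>\<^sup>+w. (\<integral>\<^sup>+z. k (snd w, z) \<partial>\<nu>) * f w \<partial>\<pi>)"
      by (subst M_int) (auto simp: nn_integral_multc)
    also have "\<dots> = (\<integral>\<^sup>+w. f w \<partial>\<pi>)"
      using AE_k1 by (intro nn_integral_cong_AE) auto
    finally show ?thesis .
  qed
  have M_snd: "(\<integral>\<^sup>+p. f (snd (fst p), snd p) \<partial>M) = (\<integral>\<^sup>+y. (\<integral>\<^sup>+z. f (y, z) * k (y, z) \<partial>\<nu>) \<partial>\<nu>')"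
    if [measurable]: "f \<in> borel_measurable (borel \<Otimes>\<^sub>M borel)" for f
    using couplings_nn_integral(2)[OF \<pi>, of "\<lambda>y. \<integral>\<^sup>+z. f (y, z) * k (y, z) \<partial>\<nu>"]
    by (subst M_int) (auto simp: mult.commute)
  have M_snd': "(\<integral>\<^sup>+p. f (snd p) \<partial>M) = (\<integral>\<^sup>+z. f z \<partial>\<nu>)"
    if [measurable]: "f \<in> borel_measurable borel" for f
  proof -
    interpret NN: pair_sigma_finite \<nu> \<nu>' ..
    have "(\<integral>\<^sup>+p. f (snd p) \<partial>M) = (\<integral>\<^sup>+y. (\<integral>\<^sup>+z. f z * k (y, z) \<partial>\<nu>) \<partial>\<nu>')"
      using M_snd[of "\<lambda>p. f (snd p)"] by simp
    also have "\<dots> = (\<integral>\<^sup>+z. (\<integral>\<^sup>+y. f z * k (y, z) \<partial>\<nu>') \<partial>\<nu>)"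
      using NN.Fubini'[of "\<lambda>z y. f z * k (y, z)"] by simp
    also have "\<dots> = (\<integral>\<^sup>+z. f z * (\<integral>\<^sup>+y. k (y, z) \<partial>\<nu>') \<partial>\<nu>)"
      by (simp add: nn_integral_cmult)
    also have "\<dots> = (\<integral>\<^sup>+z. f z \<partial>\<nu>)"
      using k2 by (intro nn_integral_cong_AE) auto
    finally show ?thesis .
  qed
  have "emeasure M (space M) = 1"
    using M_fst[of "\<lambda>_. 1"] by (simp add: P.emeasure_space_1)
  then interpret M: prob_space M by (rule prob_spaceI)
  have sr[measurable_cong]: "sets \<rho> = sets (borel \<Otimes>\<^sub>M borel)" by (simp add: \<rho>_def)
  have "prob_space \<rho>" unfolding \<rho>_def by (rule M.prob_space_distr) measurable
  have em: "emeasure (distr \<rho> borel h) A = (\<integral>\<^sup>+p. indicator A (h (fst (fst p), snd p)) \<partial>M)"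
    if [measurable]: "A \<in> sets borel" and [measurable]: "h \<in> (borel \<Otimes>\<^sub>M borel) \<rightarrow>\<^sub>M borel"
    for h :: "'a \<times> 'a \<Rightarrow> 'a" and A
    by (simp add: \<rho>_def distr_distr comp_def emeasure_distr flip: nn_integral_indicator)
       (subst nn_integral_distr; simp)
  have "distr \<rho> borel fst = \<mu>"
  proof (rule measure_eqI)
    show "sets (distr \<rho> borel fst) = sets \<mu>" using couplingsD(3)[OF \<pi>] by auto
    fix A assume "A \<in> sets (distr \<rho> borel fst)"
    then have [measurable]: "A \<in> sets borel" by simp
    have sm: "sets \<mu> = sets borel" using couplingsD(3)[OF \<pi>] by auto
    have "emeasure (distr \<rho> borel fst) A = (\<integral>\<^sup>+w. indicator A (fst w) \<partial>\<pi>)"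
      using M_fst[of "\<lambda>w. indicator A (fst w)"] by (simp add: em)
    then show "emeasure (distr \<rho> borel fst) A = emeasure \<mu> A"
      using couplings_nn_integral(1)[OF \<pi>, of "indicator A"] by (simp add: sm)
  qed
  moreover have "distr \<rho> borel snd = \<nu>"
  proof (rule measure_eqI)
    show "sets (distr \<rho> borel snd) = sets \<nu>" using sn by auto
    fix A assume "A \<in> sets (distr \<rho> borel snd)"
    then have [measurable]: "A \<in> sets borel" by simp
    show "emeasure (distr \<rho> borel snd) A = emeasure \<nu> A"
      using M_snd'[of "indicator A"] by (simp add: em)
  qed
  ultimately have "\<rho> \<in> couplings \<mu> \<nu>"
    using \<open>prob_space \<rho>\<close> sr by (simp add: couplings_def space_prob_algebra)
  then have "W1 \<mu> \<nu> \<le> (\<integral>\<^sup>+w. ennreal (norm (fst w - snd w)) \<partial>\<rho>)"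
    by (rule W1_le_cost)
  also have "\<dots> = (\<integral>\<^sup>+p. ennreal (norm (fst (fst p) - snd p)) \<partial>M)"
    by (simp add: \<rho>_def nn_integral_distr)
  also have "\<dots> \<le> (\<integral>\<^sup>+p. ennreal (norm (fst (fst p) - snd (fst p)))
                       + ennreal (norm (snd (fst p) - snd p)) \<partial>M)"
    by (intro nn_integral_mono)
       (simp flip: ennreal_plus add: norm_triangle_le_diff, metis norm_triangle_ineq diff_add_cancel add_diff_eq)
  also have "\<dots> = (\<integral>\<^sup>+p. ennreal (norm (fst (fst p) - snd (fst p))) \<partial>M)
                   + (\<integral>\<^sup>+p. ennreal (norm (snd (fst p) - snd p)) \<partial>M)"
    by (rule nn_integral_add) measurable
  also have "\<dots> = (\<integral>\<^sup>+w. ennreal (norm (fst w - snd w)) \<partial>\<pi>)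
           + (\<integral>\<^sup>+y. (\<integral>\<^sup>+z. ennreal (norm (y - z)) * k (y, z) \<partial>\<nu>) \<partial>\<nu>')"
    using M_fst[of "\<lambda>w. ennreal (norm (fst w - snd w))"]
      M_snd[of "\<lambda>w. ennreal (norm (fst w - snd w))"] by simp
  finally show ?thesis .
qed

section \<open>Coupling two measures through a quantisation\<close>

text \<open>
  The maximal coupling of two discrete laws: the common part \<open>min(a, b)\<close> stays on the diagonal, and the
  two excesses, which have the same total mass \<open>\<delta>\<close>, are coupled independently. Only the excess moves,
  so the off-diagonal mass is at most the \<open>\<ell>\<^sup>1\<close> distance of \<open>a\<close> and \<open>b\<close>.
\<close>

lemma finite_maximal_coupling:
  fixes a b :: "'i \<Rightarrow> real"
  assumes D: "finite D" and a: "\<And>i. 0 \<le> a i" and b: "\<And>i. 0 \<le> b i"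
    and ab: "(\<Sum>i\<in>D. a i) = (\<Sum>i\<in>D. b i)"
  obtains c where "\<And>i j. 0 \<le> c i j" "\<And>i. i \<in> D \<Longrightarrow> (\<Sum>j\<in>D. c i j) = a i"
    "\<And>j. j \<in> D \<Longrightarrow> (\<Sum>i\<in>D. c i j) = b j"
    "(\<Sum>i\<in>D. \<Sum>j\<in>D. if i = j then 0 else c i j) \<le> (\<Sum>i\<in>D. \<bar>a i - b i\<bar>)"
proof -
  define m where "m i = min (a i) (b i)" for i
  define \<delta> where "\<delta> = (\<Sum>i\<in>D. a i - m i)"
  have \<delta>': "\<delta> = (\<Sum>i\<in>D. b i - m i)"
    using ab by (simp add: \<delta>_def sum_subtractf)
  have ma: "0 \<le> a i - m i" and mb: "0 \<le> b i - m i" and m0: "0 \<le> m i" for i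
    using a[of i] b[of i] by (auto simp: m_def)
  \<comment> \<open>If \<open>\<delta> = 0\<close>, both excesses vanish on \<open>D\<close> and the quotient, which is then \<open>0\<close>, is the right value.\<close>
  define c where "c i j = (if i = j then m i else 0) + (a i - m i) * (b j - m j) / \<delta>" for i j
  have "0 \<le> \<delta>" unfolding \<delta>_def by (intro sum_nonneg ma)
  have c0: "0 \<le> c i j" for i j
    using \<open>0 \<le> \<delta>\<close> ma mb m0 by (auto simp: c_def)
  have za: "a i - m i = 0" if "\<delta> = 0" "i \<in> D" for i
    using that sum_nonneg_eq_0_iff[OF D, of "\<lambda>i. a i - m i"] ma by (auto simp: \<delta>_def)
  have zb: "b i - m i = 0" if "\<delta> = 0" "i \<in> D" for i
    using that sum_nonneg_eq_0_iff[OF D, of "\<lambda>i. b i - m i"] mb by (auto simp: \<delta>')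
  have row: "(\<Sum>j\<in>D. c i j) = a i" if i: "i \<in> D" for i
  proof -
    have "(\<Sum>j\<in>D. c i j) = m i + (a i - m i) * (\<Sum>j\<in>D. b j - m j) / \<delta>"
      using D i by (simp add: c_def sum.distrib flip: sum_distrib_left sum_divide_distrib)
    then show ?thesis using za[OF _ i] unfolding \<delta>'[symmetric] by (cases "\<delta> = 0") auto
  qed
  have col: "(\<Sum>i\<in>D. c i j) = b j" if j: "j \<in> D" for j
  proof -
    have "(\<Sum>i\<in>D. c i j) = m j + (\<Sum>i\<in>D. a i - m i) * (b j - m j) / \<delta>"
      using D j by (simp add: c_def sum.distrib flip: sum_distrib_right sum_divide_distrib)
    then show ?thesis using zb[OF _ j] unfolding \<delta>_def[symmetric] by (cases "\<delta> = 0") auto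
  qed
  have "(\<Sum>i\<in>D. \<Sum>j\<in>D. if i = j then 0 else c i j) \<le> (\<Sum>i\<in>D. \<bar>a i - b i\<bar>)"
  proof (rule sum_mono)
    fix i assume i: "i \<in> D"
    have "(\<Sum>j\<in>D. if i = j then 0 else c i j) = (\<Sum>j\<in>D. c i j - (if i = j then c i i else 0))"
      by (rule sum.cong) auto
    also have "\<dots> = a i - c i i"
      using D i by (simp add: sum_subtractf row)
    also have "\<dots> \<le> a i - m i"
      using \<open>0 \<le> \<delta>\<close> ma mb by (simp add: c_def)
    also have "\<dots> \<le> \<bar>a i - b i\<bar>" by (auto simp: m_def)
    finally show "(\<Sum>j\<in>D. if i = j then 0 else c i j) \<le> \<bar>a i - b i\<bar>" .
  qed
  with c0 row col show thesis by (rule that)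
qed

lemma nn_integral_simple_compose:
  assumes T: "simple_function M T"
  shows "(\<integral>\<^sup>+x. h (T x) \<partial>M) = (\<Sum>d\<in>T ` space M. h d * emeasure M (T -` {d} \<inter> space M))"
proof -
  note simple_functionD[OF T, measurable]
  have "(\<integral>\<^sup>+x. h (T x) \<partial>M)
      = (\<integral>\<^sup>+x. (\<Sum>d\<in>T ` space M. h d * indicator (T -` {d} \<inter> space M) x) \<partial>M)"
  proof (rule nn_integral_cong)
    fix x assume "x \<in> space M"
    then have "(\<Sum>d\<in>T ` space M. h d * indicator (T -` {d} \<inter> space M) x)
        = (\<Sum>d\<in>T ` space M. if d = T x then h d else 0)"
      by (intro sum.cong) (auto split: split_indicator)
    then show "h (T x) = (\<Sum>d\<in>T ` space M. h d * indicator (T -` {d} \<inter> space M) x)"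
      using \<open>x \<in> space M\<close> simple_functionD(1)[OF T] by simp
  qed
  also have "\<dots> = (\<Sum>d\<in>T ` space M. h d * emeasure M (T -` {d} \<inter> space M))"
    by (simp add: nn_integral_sum nn_integral_cmult_indicator)
  finally show ?thesis .
qed

text \<open>
  A coupling matrix \<open>c\<close> of the images under \<open>T\<close> is turned into a density by spreading the mass \<open>c d j\<close>
  over the cell of \<open>j\<close> proportionally to \<open>\<nu>\<close>. Cells without mass are harmless: there \<open>b j = 0\<close>
  forces \<open>c d j = 0\<close>. The lemma serves both marginals, with \<open>c\<close> transposed for the second.
\<close>

lemma quantised_coupling_marginal:
  assumes "prob_space \<nu>" "simple_function \<nu> T"
    and c0: "\<And>i j. 0 \<le> c i j"
    and c_le: "\<And>i j. i \<in> T ` space \<nu> \<Longrightarrow> j \<in> T ` space \<nu> \<Longrightarrow> c i j \<le> b j"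
    and row: "(\<Sum>j\<in>T ` space \<nu>. c d j) = \<alpha>" and "\<alpha> > 0" and d: "d \<in> T ` space \<nu>"
    and b: "\<And>j. b j = measure \<nu> (T -` {j} \<inter> space \<nu>)"
  shows "(\<integral>\<^sup>+z. ennreal (c d (T z) / (\<alpha> * b (T z))) \<partial>\<nu>) = 1"
proof -
  interpret prob_space \<nu> by fact
  have "(\<integral>\<^sup>+z. ennreal (c d (T z) / (\<alpha> * b (T z))) \<partial>\<nu>)
      = (\<Sum>j\<in>T ` space \<nu>. ennreal (c d j / (\<alpha> * b j)) * emeasure \<nu> (T -` {j} \<inter> space \<nu>))"
    by (rule nn_integral_simple_compose[OF assms(2), of "\<lambda>j. ennreal (c d j / (\<alpha> * b j))"])
  also have "\<dots> = (\<Sum>j\<in>T ` space \<nu>. ennreal (c d j / \<alpha>))"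
  proof (rule sum.cong)
    fix j assume "j \<in> T ` space \<nu>"
    then have "b j = 0 \<Longrightarrow> c d j = 0" using c_le[OF d, of j] c0[of d j] by auto
    moreover have "b j \<ge> 0" by (simp add: b)
    ultimately show "ennreal (c d j / (\<alpha> * b j)) * emeasure \<nu> (T -` {j} \<inter> space \<nu>) = ennreal (c d j / \<alpha>)"
      using \<open>\<alpha> > 0\<close> c0[of d j]
      by (cases "b j = 0") (auto simp: emeasure_eq_measure simp flip: b ennreal_mult)
  qed simp
  also have "\<dots> = ennreal ((\<Sum>j\<in>T ` space \<nu>. c d j) / \<alpha>)"
    using c0 \<open>\<alpha> > 0\<close> by (subst sum_ennreal) (auto simp: sum_divide_distrib)
  also have "\<dots> = 1" using row \<open>\<alpha> > 0\<close> by simp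
  finally show ?thesis .
qed

text \<open>
  To move from \<open>y\<close> to \<open>z\<close>, pass through \<open>T y\<close> and \<open>T z\<close>. The outer two legs cost the quantisation
  errors of \<open>\<mu>\<close> and \<open>\<nu>\<close> whatever the coupling is. The middle leg is free when \<open>T y = T z\<close> and costs
  at most \<open>L\<close> otherwise; under the maximal coupling the latter has probability at most \<open>\<delta>\<close>.
\<close>

lemma quantised_coupling_density:
  fixes \<mu> \<nu> :: "'a::euclidean_space measure"
  assumes \<mu>: "\<mu> \<in> space (prob_algebra borel)" and \<nu>: "\<nu> \<in> space (prob_algebra borel)"
    and T: "simple_function borel T"
    and L: "\<And>y z. norm (T y - T z) \<le> L"
    and \<delta>: "(\<Sum>d\<in>range T. \<bar>measure \<mu> (T -` {d}) - measure \<nu> (T -` {d})\<bar>) \<le> \<delta>"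
  obtains k :: "'a \<times> 'a \<Rightarrow> ennreal" where "k \<in> borel_measurable (borel \<Otimes>\<^sub>M borel)"
    "AE y in \<mu>. (\<integral>\<^sup>+z. k (y, z) \<partial>\<nu>) = 1" "AE z in \<nu>. (\<integral>\<^sup>+y. k (y, z) \<partial>\<mu>) = 1"
    "(\<integral>\<^sup>+y. (\<integral>\<^sup>+z. ennreal (norm (y - z)) * k (y, z) \<partial>\<nu>) \<partial>\<mu>)
      \<le> (\<integral>\<^sup>+y. ennreal (norm (y - T y)) \<partial>\<mu>) + (\<integral>\<^sup>+z. ennreal (norm (z - T z)) \<partial>\<nu>) + ennreal (L * \<delta>)"
proof -
  have sm[measurable_cong]: "sets \<mu> = sets borel" and pm: "prob_space \<mu>"
    using \<mu> by (auto simp: space_prob_algebra)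
  have sn[measurable_cong]: "sets \<nu> = sets borel" and pn: "prob_space \<nu>"
    using \<nu> by (auto simp: space_prob_algebra)
  interpret M: prob_space \<mu> by (rule pm)
  interpret N: prob_space \<nu> by (rule pn)
  interpret MN: pair_sigma_finite \<nu> \<mu> ..
  have spm[simp]: "space \<mu> = UNIV" and spn[simp]: "space \<nu> = UNIV"
    using sets_eq_imp_space_eq[OF sm] sets_eq_imp_space_eq[OF sn] by auto
  have Tm: "simple_function \<mu> T" and Tn: "simple_function \<nu> T"
    using T by (auto simp: simple_function_def sm sn)
  have [measurable]: "T \<in> borel \<rightarrow>\<^sub>M borel" by (rule borel_measurable_simple_function[OF T])
  have fin: "finite (range T)" using simple_functionD(1)[OF T] by simp
  have [measurable]: "T -` {d} \<in> sets borel" for d using simple_functionD(2)[OF T, of "{d}"] by simp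
  define a where "a d = measure \<mu> (T -` {d})" for d
  define b where "b d = measure \<nu> (T -` {d})" for d
  have sum1: "(\<Sum>d\<in>range T. measure Q (T -` {d})) = 1" if "prob_space Q" "sets Q = sets borel" for Q
  proof -
    interpret Q: prob_space Q by fact
    have "(\<Sum>d\<in>range T. measure Q (T -` {d})) = measure Q (\<Union>d\<in>range T. T -` {d})"
    proof (rule Q.finite_measure_finite_Union[symmetric, OF fin])
      show "(\<lambda>d. T -` {d}) ` range T \<subseteq> sets Q" unfolding that(2) by (intro image_subsetI) measurable
      show "disjoint_family_on (\<lambda>d. T -` {d}) (range T)" by (auto simp: disjoint_family_on_def)
    qed
    also have "(\<Union>d\<in>range T. T -` {d}) = space Q"
      using sets_eq_imp_space_eq[OF that(2)] by auto
    finally show ?thesis by (simp add: Q.prob_space)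
  qed
  have ab: "(\<Sum>d\<in>range T. a d) = (\<Sum>d\<in>range T. b d)"
    unfolding a_def b_def using sum1[OF pm sm] sum1[OF pn sn] by simp
  have a0: "0 \<le> a d" and b0: "0 \<le> b d" for d by (auto simp: a_def b_def)
  obtain c where c0: "\<And>i j. 0 \<le> c i j"
    and row: "\<And>i. i \<in> range T \<Longrightarrow> (\<Sum>j\<in>range T. c i j) = a i"
    and col: "\<And>j. j \<in> range T \<Longrightarrow> (\<Sum>i\<in>range T. c i j) = b j"
    and off: "(\<Sum>i\<in>range T. \<Sum>j\<in>range T. if i = j then 0 else c i j) \<le> (\<Sum>i\<in>range T. \<bar>a i - b i\<bar>)"
    using finite_maximal_coupling[OF fin a0 b0 ab] by blast
  have cb: "c i j \<le> b j" and ca: "c i j \<le> a i" if "i \<in> range T" "j \<in> range T" for i j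
    using member_le_sum[of i "range T" "\<lambda>i. c i j"] member_le_sum[of j "range T" "c i"]
      row[of i] col[of j] fin c0 that by auto
  define k where "k p = ennreal (c (T (fst p)) (T (snd p)) / (a (T (fst p)) * b (T (snd p))))" for p :: "'a \<times> 'a"
  have TI: "T \<in> borel \<rightarrow>\<^sub>M count_space (range T)"
    using fin by (subst measurable_count_space_eq2) auto
  have km2: "(\<lambda>p. h (T (fst p)) (T (snd p))) \<in> borel_measurable (borel \<Otimes>\<^sub>M borel)"
    for h :: "'a \<Rightarrow> 'a \<Rightarrow> ennreal"
  proof -
    have "(\<lambda>p. h i (T (snd p))) \<in> borel_measurable (borel \<Otimes>\<^sub>M borel)" for i
      by (rule measurable_compose[OF measurable_compose[OF measurable_snd TI]]) simp
    then show ?thesis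
      by (rule measurable_compose_countable'[OF _ measurable_compose[OF measurable_fst TI]
            countable_finite[OF fin]])
  qed
  have k[measurable]: "k \<in> borel_measurable (borel \<Otimes>\<^sub>M borel)"
    unfolding k_def by (rule km2)
  \<comment> \<open>Cells without mass, where the density takes the meaningless value of a division by zero, are negligible.\<close>
  have pos: "AE y in Q. measure Q (T -` {T y}) > 0" if "prob_space Q" "sets Q = sets borel" for Q
  proof -
    interpret Q: prob_space Q by fact
    note [measurable_cong] = that(2)
    have "AE y in Q. \<forall>d\<in>range T. measure Q (T -` {d}) = 0 \<longrightarrow> y \<notin> T -` {d}"
    proof (intro AE_finite_allI[OF fin])
      fix d
      show "AE y in Q. measure Q (T -` {d}) = 0 \<longrightarrow> y \<notin> T -` {d}"
      proof (cases "measure Q (T -` {d}) = 0")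
        case True
        then have "T -` {d} \<in> null_sets Q"
          using that by (intro null_setsI) (auto simp: Q.emeasure_eq_measure)
        then have "AE y in Q. y \<notin> T -` {d}" by (rule AE_not_in)
        then show ?thesis by eventually_elim simp
      qed auto
    qed
    then show ?thesis
      by (rule AE_mp) (auto simp: zero_less_measure_iff intro!: AE_I2)
  qed
  have k1: "AE y in \<mu>. (\<integral>\<^sup>+z. k (y, z) \<partial>\<nu>) = 1"
    using pos[OF pm sm]
  proof eventually_elim
    case (elim y)
    then show ?case
      using quantised_coupling_marginal[OF pn Tn, of c b "T y" "a (T y)"] c0 cb row[of "T y"]
      by (simp add: k_def a_def b_def)
  qed
  have k2: "AE z in \<nu>. (\<integral>\<^sup>+y. k (y, z) \<partial>\<mu>) = 1"
    using pos[OF pn sn]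
  proof eventually_elim
    case (elim z)
    then show ?case
      using quantised_coupling_marginal[OF pm Tm, of "\<lambda>i j. c j i" a "T z" "b (T z)"] c0 ca col[of "T z"]
      by (simp add: k_def a_def b_def mult.commute)
  qed
  have L0: "0 \<le> L" using L[of 0 0] by simp
  have "(\<integral>\<^sup>+y. (\<integral>\<^sup>+z. ennreal (norm (T y - T z)) * k (y, z) \<partial>\<nu>) \<partial>\<mu>)
      \<le> (\<integral>\<^sup>+y. (\<integral>\<^sup>+z. ennreal L * (if T y = T z then 0 else k (y, z)) \<partial>\<nu>) \<partial>\<mu>)"
    using L by (intro nn_integral_mono) (auto intro!: mult_right_mono ennreal_leI)
  also have "\<dots> = (\<integral>\<^sup>+y. (\<integral>\<^sup>+z. ennreal L * (if T y = T z then 0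
                 else ennreal (c (T y) (T z) / (a (T y) * b (T z)))) \<partial>\<nu>) \<partial>\<mu>)"
    by (simp add: k_def cong: if_cong)
  also have "\<dots> = (\<integral>\<^sup>+y. (\<Sum>j\<in>range T. ennreal L * (if T y = j then 0
                 else ennreal (c (T y) j / (a (T y) * b j))) * ennreal (b j)) \<partial>\<mu>)"
  proof (rule nn_integral_cong)
    fix y
    show "(\<integral>\<^sup>+z. ennreal L * (if T y = T z then 0
                 else ennreal (c (T y) (T z) / (a (T y) * b (T z)))) \<partial>\<nu>)
        = (\<Sum>j\<in>range T. ennreal L * (if T y = j then 0
                 else ennreal (c (T y) j / (a (T y) * b j))) * ennreal (b j))"
      using nn_integral_simple_compose[OF Tn, of "\<lambda>j. ennreal L * (if T y = j then 0
                 else ennreal (c (T y) j / (a (T y) * b j)))"]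
      by (simp add: N.emeasure_eq_measure b_def)
  qed
  also have "\<dots> = (\<Sum>i\<in>range T. (\<Sum>j\<in>range T. ennreal L * (if i = j then 0
                 else ennreal (c i j / (a i * b j))) * ennreal (b j)) * ennreal (a i))"
    using nn_integral_simple_compose[OF Tm, of "\<lambda>i. \<Sum>j\<in>range T. ennreal L * (if i = j then 0
                 else ennreal (c i j / (a i * b j))) * ennreal (b j)"]
    by (simp add: M.emeasure_eq_measure a_def)
  also have "\<dots> = (\<Sum>i\<in>range T. \<Sum>j\<in>range T. ennreal (L * (if i = j then 0 else c i j)))"
    unfolding sum_distrib_right
  proof (intro sum.cong refl)
    fix i j assume ij: "i \<in> range T" "j \<in> range T"
    show "ennreal L * (if i = j then 0 else ennreal (c i j / (a i * b j))) * ennreal (b j) * ennreal (a i)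
        = ennreal (L * (if i = j then 0 else c i j))"
    proof (cases "a i = 0 \<or> b j = 0")
      case True
      then have "c i j = 0" using ca[OF ij] cb[OF ij] c0[of i j] by auto
      then show ?thesis by simp
    next
      case False
      then show ?thesis using a0[of i] b0[of j] c0[of i j] L0 by (simp flip: ennreal_mult)
    qed
  qed
  also have "\<dots> = ennreal (L * (\<Sum>i\<in>range T. \<Sum>j\<in>range T. if i = j then 0 else c i j))"
    using c0 L0 by (simp add: sum_ennreal sum_nonneg sum_distrib_left)
  also have "\<dots> \<le> ennreal (L * \<delta>)"
    using off \<delta> L0 by (intro ennreal_leI mult_left_mono) (auto simp: a_def b_def)
  finally have off_cost: "(\<integral>\<^sup>+y. (\<integral>\<^sup>+z. ennreal (norm (T y - T z)) * k (y, z) \<partial>\<nu>) \<partial>\<mu>) \<le> ennreal (L * \<delta>)" .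
  have tri: "ennreal (norm (y - z)) * k (y, z)
      \<le> ennreal (norm (y - T y)) * k (y, z) + ennreal (norm (z - T z)) * k (y, z)
        + ennreal (norm (T y - T z)) * k (y, z)" for y z
  proof -
    have "norm (y - z) \<le> norm (y - T y) + norm (z - T z) + norm (T y - T z)"
      using norm_triangle_ineq[of "y - T y" "T y - z"] norm_triangle_ineq[of "T y - T z" "T z - z"]
        norm_minus_commute[of z "T z"] by simp
    then have "ennreal (norm (y - z)) \<le> ennreal (norm (y - T y)) + ennreal (norm (z - T z)) + ennreal (norm (T y - T z))"
      by (simp flip: ennreal_plus)
    then show ?thesis
      unfolding distrib_right[symmetric] by (intro mult_right_mono) auto
  qed
  have "(\<integral>\<^sup>+y. (\<integral>\<^sup>+z. ennreal (norm (y - z)) * k (y, z) \<partial>\<nu>) \<partial>\<mu>)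
     \<le> (\<integral>\<^sup>+y. (\<integral>\<^sup>+z. ennreal (norm (y - T y)) * k (y, z) + ennreal (norm (z - T z)) * k (y, z)
        + ennreal (norm (T y - T z)) * k (y, z) \<partial>\<nu>) \<partial>\<mu>)"
    by (intro nn_integral_mono tri)
  also have "\<dots> = (\<integral>\<^sup>+y. (\<integral>\<^sup>+z. ennreal (norm (y - T y)) * k (y, z) \<partial>\<nu>) \<partial>\<mu>)
      + (\<integral>\<^sup>+y. (\<integral>\<^sup>+z. ennreal (norm (z - T z)) * k (y, z) \<partial>\<nu>) \<partial>\<mu>)
      + (\<integral>\<^sup>+y. (\<integral>\<^sup>+z. ennreal (norm (T y - T z)) * k (y, z) \<partial>\<nu>) \<partial>\<mu>)"
    by (simp add: nn_integral_add)
  also have "(\<integral>\<^sup>+y. (\<integral>\<^sup>+z. ennreal (norm (y - T y)) * k (y, z) \<partial>\<nu>) \<partial>\<mu>)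
      = (\<integral>\<^sup>+y. ennreal (norm (y - T y)) \<partial>\<mu>)"
    using k1 by (intro nn_integral_cong_AE) (auto simp: nn_integral_cmult)
  also have "(\<integral>\<^sup>+y. (\<integral>\<^sup>+z. ennreal (norm (z - T z)) * k (y, z) \<partial>\<nu>) \<partial>\<mu>)
      = (\<integral>\<^sup>+z. (\<integral>\<^sup>+y. ennreal (norm (z - T z)) * k (y, z) \<partial>\<mu>) \<partial>\<nu>)"
    using MN.Fubini'[of "\<lambda>z y. ennreal (norm (z - T z)) * k (y, z)"] by simp
  also have "\<dots> = (\<integral>\<^sup>+z. ennreal (norm (z - T z)) \<partial>\<nu>)"
    using k2 by (intro nn_integral_cong_AE) (auto simp: nn_integral_cmult)
  finally have "(\<integral>\<^sup>+y. (\<integral>\<^sup>+z. ennreal (norm (y - z)) * k (y, z) \<partial>\<nu>) \<partial>\<mu>)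
      \<le> (\<integral>\<^sup>+y. ennreal (norm (y - T y)) \<partial>\<mu>) + (\<integral>\<^sup>+z. ennreal (norm (z - T z)) \<partial>\<nu>) + ennreal (L * \<delta>)"
    using off_cost by (meson add_left_mono order_trans)
  with k k1 k2 show thesis by (rule that)
qed

section \<open>Convexity of the Wasserstein distance along mixtures\<close>

lemma bind_in_prob_algebra:
  assumes "prob_space N" "K \<in> N \<rightarrow>\<^sub>M prob_algebra R"
  shows "N \<bind> K \<in> space (prob_algebra R)"
  using prob_space_bind'[of N N K R] sets_bind'[of N N K R] assms by (simp add: space_prob_algebra)

text \<open>
  For countably many components, a nearly optimal coupling can be chosen for each of them separately.
  Their mixture is a coupling, and measurability in the parameter is automatic.
\<close>

lemma W1_bind_countable:
  fixes \<mu> :: "'a::euclidean_space measure" and c :: "'i \<Rightarrow> real"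
  assumes N: "prob_space N" and r[measurable]: "r \<in> N \<rightarrow>\<^sub>M count_space I" and I: "countable I"
    and \<mu>: "\<mu> \<in> space (prob_algebra borel)"
    and Q: "\<And>i. i \<in> I \<Longrightarrow> Q i \<in> space (prob_algebra borel)"
    and c: "\<And>i. i \<in> I \<Longrightarrow> W1 \<mu> (Q i) \<le> ennreal (c i)"
  shows "W1 \<mu> (N \<bind> (\<lambda>x. Q (r x))) \<le> (\<integral>\<^sup>+x. ennreal (c (r x)) \<partial>N)"
proof (rule ennreal_le_epsilon)
  fix e :: real assume "0 < e"
  interpret prob_space N by fact
  have "\<exists>\<pi>. \<pi> \<in> couplings \<mu> (Q i) \<and> (\<integral>\<^sup>+z. ennreal (norm (fst z - snd z)) \<partial>\<pi>) < ennreal (c i) + ennreal e"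
    if "i \<in> I" for i
  proof -
    have "ennreal (c i) < ennreal (c i) + ennreal e"
      using \<open>0 < e\<close> by (simp add: ennreal_less_top)
    then have "W1 \<mu> (Q i) < ennreal (c i) + ennreal e"
      using c[OF that] by (rule le_less_trans[rotated])
    then show ?thesis by (rule W1_lessE) auto
  qed
  then obtain \<pi> where \<pi>: "\<And>i. i \<in> I \<Longrightarrow> \<pi> i \<in> couplings \<mu> (Q i)"
    and cost: "\<And>i. i \<in> I \<Longrightarrow> (\<integral>\<^sup>+z. ennreal (norm (fst z - snd z)) \<partial>\<pi> i) < ennreal (c i) + ennreal e"
    by metis
  have rI: "r x \<in> I" if "x \<in> space N" for x using measurable_space[OF r that] by simp
  define K where "K x = \<pi> (r x)" for x
  have K: "K \<in> N \<rightarrow>\<^sub>M prob_algebra (borel \<Otimes>\<^sub>M borel)"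
  proof -
    have "\<pi> \<in> count_space I \<rightarrow>\<^sub>M prob_algebra (borel \<Otimes>\<^sub>M borel)"
      using \<pi> by (auto simp: couplings_def)
    from measurable_compose[OF r this] show ?thesis by (simp add: K_def[abs_def])
  qed
  note K' = measurable_prob_algebraD[OF K]
  define \<Gamma> where "\<Gamma> = N \<bind> K"
  have \<Gamma>: "\<Gamma> \<in> space (prob_algebra (borel \<Otimes>\<^sub>M borel))"
    unfolding \<Gamma>_def by (rule bind_in_prob_algebra[OF N K])
  have Kc: "K x \<in> couplings \<mu> (Q (r x))" if "x \<in> space N" for x
    using \<pi>[OF rI[OF that]] by (simp add: K_def)
  have "distr \<Gamma> borel fst = N \<bind> (\<lambda>x. distr (K x) borel fst)"
    unfolding \<Gamma>_def by (rule distr_bind[OF K' not_empty]) measurable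
  also have "\<dots> = N \<bind> (\<lambda>x. \<mu>)"
    using couplingsD(3)[OF Kc] by (intro bind_cong_All) auto
  also have "\<dots> = \<mu>"
    using \<mu> by (intro bind_const' N) (auto simp: space_prob_algebra prob_space_imp_subprob_space)
  finally have 1: "distr \<Gamma> borel fst = \<mu>" .
  have "distr \<Gamma> borel snd = N \<bind> (\<lambda>x. distr (K x) borel snd)"
    unfolding \<Gamma>_def by (rule distr_bind[OF K' not_empty]) measurable
  also have "\<dots> = N \<bind> (\<lambda>x. Q (r x))"
    using couplingsD(4)[OF Kc] by (intro bind_cong_All) auto
  finally have 2: "distr \<Gamma> borel snd = N \<bind> (\<lambda>x. Q (r x))" .
  have "\<Gamma> \<in> couplings \<mu> (N \<bind> (\<lambda>x. Q (r x)))"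
    using \<Gamma> 1 2 by (simp add: couplings_def)
  then have "W1 \<mu> (N \<bind> (\<lambda>x. Q (r x))) \<le> (\<integral>\<^sup>+z. ennreal (norm (fst z - snd z)) \<partial>\<Gamma>)"
    by (rule W1_le_cost)
  also have "\<dots> = (\<integral>\<^sup>+x. (\<integral>\<^sup>+z. ennreal (norm (fst z - snd z)) \<partial>K x) \<partial>N)"
    unfolding \<Gamma>_def by (rule nn_integral_bind[OF _ K']) measurable
  also have "\<dots> \<le> (\<integral>\<^sup>+x. ennreal (c (r x)) + ennreal e \<partial>N)"
    using cost[OF rI] by (intro nn_integral_mono) (auto simp: K_def intro: less_imp_le)
  also have "\<dots> = (\<integral>\<^sup>+x. ennreal (c (r x)) \<partial>N) + ennreal e"
    using measurable_compose[OF r, of "\<lambda>i. ennreal (c i)"]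
    by (subst nn_integral_add) (auto simp: emeasure_space_1)
  finally show "W1 \<mu> (N \<bind> (\<lambda>x. Q (r x))) \<le> (\<integral>\<^sup>+x. ennreal (c (r x)) \<partial>N) + ennreal e" .
qed

text \<open>
  One representative per fibre of \<open>S\<close>, within \<open>e\<close> of the infimum of \<open>g\<close> on that fibre. As the
  bound is pointwise, the integral of \<open>g\<close> grows by at most \<open>e\<close> under any probability measure when each
  point is replaced by its representative. The representative is a function of the value of \<open>S\<close>, so it is
  measurable as soon as \<open>S\<close> is a simple function.
\<close>

lemma near_minimal_representative:
  fixes g :: "'b \<Rightarrow> ennreal" and S :: "'b \<Rightarrow> 'c"
  assumes "0 < e"
  obtains \<rho> where "\<And>x. x \<in> X \<Longrightarrow> \<rho> (S x) \<in> X" "\<And>x. x \<in> X \<Longrightarrow> S (\<rho> (S x)) = S x"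
    "\<And>x. x \<in> X \<Longrightarrow> g (\<rho> (S x)) \<le> g x + ennreal e"
proof -
  have "\<exists>y. y \<in> X \<and> S y = s \<and> (\<forall>x\<in>X. S x = s \<longrightarrow> g y \<le> g x + ennreal e)" if s: "s \<in> S ` X" for s
  proof -
    define i where "i = (INF z\<in>{z\<in>X. S z = s}. g z)"
    have il: "i \<le> g x" if "x \<in> X" "S x = s" for x
      unfolding i_def using that by (intro INF_lower) auto
    show ?thesis
    proof (cases "i = \<infinity>")
      case True
      then have "g x = \<infinity>" if "x \<in> X" "S x = s" for x
        using il[OF that] by (simp add: top_unique)
      then show ?thesis using s by (auto simp: top_unique)
    next
      case False
      then have "i < i + ennreal e"
        using \<open>0 < e\<close> by (simp add: ennreal_add_left_cancel_less top.not_eq_extremum)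
      then obtain y where "y \<in> X" "S y = s" "g y < i + ennreal e"
        unfolding i_def by (auto simp: INF_less_iff)
      moreover have "i + ennreal e \<le> g x + ennreal e" if "x \<in> X" "S x = s" for x
        using il[OF that] by (rule add_right_mono)
      ultimately have "g y \<le> g x + ennreal e" if "x \<in> X" "S x = s" for x
        using that \<open>g y < i + ennreal e\<close> by (meson less_imp_le order_trans)
      with \<open>y \<in> X\<close> \<open>S y = s\<close> show ?thesis by blast
    qed
  qed
  then obtain \<rho> where "\<And>s. s \<in> S ` X \<Longrightarrow> \<rho> s \<in> X \<and> S (\<rho> s) = s \<and> (\<forall>x\<in>X. S x = s \<longrightarrow> g (\<rho> s) \<le> g x + ennreal e)"
    by metis
  then show thesis by (intro that[of \<rho>]) auto
qed

lemma simple_approximation_of_identity: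
  fixes \<nu> :: "'a::euclidean_space measure"
  assumes [measurable_cong]: "sets \<nu> = sets borel" and m1: "(\<integral>\<^sup>+y. ennreal (norm y) \<partial>\<nu>) < \<infinity>" and "0 < e"
  obtains T L where "simple_function borel T" "\<And>y z. norm (T y - T z :: 'a) \<le> L"
    "(\<integral>\<^sup>+y. ennreal (norm (y - T y)) \<partial>\<nu>) \<le> ennreal e"
proof -
  obtain F where F: "\<And>i. simple_function borel (F i)" "\<And>x::'a. (\<lambda>i. F i x) \<longlonglongrightarrow> x"
    "\<And>i x. norm (F i x) \<le> 2 * norm x"
    using borel_measurable_implies_sequence_metric[of "\<lambda>x::'a. x" borel 0]
    unfolding dist_norm by auto
  have [measurable]: "F i \<in> borel \<rightarrow>\<^sub>M borel" for i
    by (rule borel_measurable_simple_function[OF F(1)])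
  have "(\<lambda>i. \<integral>\<^sup>+y. ennreal (norm (y - F i y)) \<partial>\<nu>) \<longlonglongrightarrow> (\<integral>\<^sup>+y. 0 \<partial>\<nu>)"
  proof (rule nn_integral_dominated_convergence[where w = "\<lambda>y. ennreal (3 * norm y)"])
    show "(\<integral>\<^sup>+y. ennreal (3 * norm y) \<partial>\<nu>) < \<infinity>"
      using m1 by (simp add: ennreal_mult nn_integral_cmult ennreal_mult_less_top)
    show "AE y in \<nu>. ennreal (norm (y - F j y)) \<le> ennreal (3 * norm y)" for j
    proof (rule AE_I2)
      fix y show "ennreal (norm (y - F j y)) \<le> ennreal (3 * norm y)"
        using F(3)[of j y] norm_triangle_ineq4[of y "F j y"] by (intro ennreal_leI) simp
    qed
    show "AE y in \<nu>. (\<lambda>i. ennreal (norm (y - F i y))) \<longlonglongrightarrow> 0"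
    proof (rule AE_I2)
      fix y
      have "(\<lambda>i. norm (y - F i y)) \<longlonglongrightarrow> norm (y - y)"
        by (intro tendsto_intros F)
      then show "(\<lambda>i. ennreal (norm (y - F i y))) \<longlonglongrightarrow> 0"
        using tendsto_ennrealI by fastforce
    qed
  qed auto
  then have "(\<lambda>i. \<integral>\<^sup>+y. ennreal (norm (y - F i y)) \<partial>\<nu>) \<longlonglongrightarrow> 0" by simp
  from order_tendstoD(2)[OF this, of "ennreal e"] \<open>0 < e\<close>
  obtain i where i: "(\<integral>\<^sup>+y. ennreal (norm (y - F i y)) \<partial>\<nu>) < ennreal e"
    by (auto simp: eventually_sequentially)
  have fin: "finite (range (F i))" using simple_functionD(1)[OF F(1)] by simp
  define B where "B = Max (norm ` range (F i))"
  have "norm (F i y) \<le> B" for y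
    unfolding B_def using fin by (intro Max_ge) auto
  then have "norm (F i y - F i z) \<le> 2 * B" for y z
    using norm_triangle_ineq4[of "F i y" "F i z"] by (smt (verit))
  then show thesis using i by (intro that[OF F(1)[of i]]) auto
qed

text \<open>
  The cells on which the masses \<open>K(x)(T = d)\<close> are almost constant come from rounding these masses down to
  multiples of \<open>1/m\<close>. The representatives have to control two quantities at once, the transport cost
  \<open>c\<close> and the quantisation error of \<open>\<nu>'\<close>; they are chosen to nearly minimise the sum, which
  suffices because only the sum enters the final estimate. The first moment of the mixture makes its
  quantisation error small.
\<close>

lemma W1_bind_le:
  fixes \<mu> :: "'a::euclidean_space measure" and K :: "'b \<Rightarrow> 'a measure" and c :: "'b \<Rightarrow> real"
  assumes N: "prob_space N" and K: "K \<in> N \<rightarrow>\<^sub>M prob_algebra borel"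
    and \<mu>: "\<mu> \<in> space (prob_algebra borel)"
    and [measurable]: "c \<in> borel_measurable N"
    and c: "\<And>x. x \<in> space N \<Longrightarrow> W1 \<mu> (K x) \<le> ennreal (c x)"
    and m1: "(\<integral>\<^sup>+y. ennreal (norm y) \<partial>(N \<bind> K)) < \<infinity>"
  shows "W1 \<mu> (N \<bind> K) \<le> (\<integral>\<^sup>+x. ennreal (c x) \<partial>N)"
proof (rule ennreal_le_epsilon)
  fix e0 :: real assume cfin: "(\<integral>\<^sup>+x. ennreal (c x) \<partial>N) < top" and "0 < e0"
  \<comment> \<open>Five errors arise: the choice of \<open>r\<close>, the quantisation of \<open>\<nu>\<close> (twice), the choice of \<open>\<pi>\<close>, and the difference of cell masses.\<close>
  define e where "e = e0 / 5"
  have "0 < e" using \<open>0 < e0\<close> by (simp add: e_def)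
  interpret prob_space N by fact
  note K'[measurable] = measurable_prob_algebraD[OF K]
  define \<nu> where "\<nu> = N \<bind> K"
  have \<nu>: "\<nu> \<in> space (prob_algebra borel)"
    unfolding \<nu>_def by (rule bind_in_prob_algebra[OF N K])
  then have "sets \<nu> = sets borel" by (simp add: space_prob_algebra)
  then obtain T L where T: "simple_function borel T" and L: "\<And>y z. norm (T y - T z :: 'a) \<le> L"
    and T\<nu>: "(\<integral>\<^sup>+y. ennreal (norm (y - T y)) \<partial>\<nu>) \<le> ennreal e"
    using simple_approximation_of_identity[OF _ m1[folded \<nu>_def] \<open>0 < e\<close>] by metis
  have L0: "0 \<le> L" using L[of 0 0] by simp
  have [measurable]: "T \<in> borel \<rightarrow>\<^sub>M borel" by (rule borel_measurable_simple_function[OF T])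
  have fin: "finite (range T)" using simple_functionD(1)[OF T] by simp
  have TB[measurable]: "T -` {d} \<in> sets borel" for d using simple_functionD(2)[OF T, of "{d}"] by simp
  have Kprob: "prob_space (K x)" if "x \<in> space N" for x
    using measurable_space[OF K that] by (simp add: space_prob_algebra)
  \<comment> \<open>With this resolution the middle leg costs at most \<open>e\<close>: the cell masses of \<open>\<nu>\<close> and \<open>\<nu>'\<close> differ by at most \<open>1/m\<close> each.\<close>
  obtain m :: nat where m: "L * card (range T) / e < real m" using reals_Archimedean2 by blast
  have m0: "0 < real m"
    using m L0 \<open>0 < e\<close> by (smt (verit) divide_nonneg_pos mult_nonneg_nonneg of_nat_0_le_iff)
  define p where "p d x = measure (K x) (T -` {d})" for d x
  have [measurable]: "p d \<in> borel_measurable N" for d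
    unfolding p_def by (rule measurable_compose[OF K' measurable_measure_subprob_algebra[OF TB]])
  have p01: "0 \<le> p d x" "x \<in> space N \<Longrightarrow> p d x \<le> 1" for d x
    using prob_space.prob_le_1[OF Kprob] by (auto simp: p_def)
  define S where "S x = (\<lambda>d. \<lfloor>real m * p d x\<rfloor>)" for x
  have S: "simple_function N S"
    unfolding simple_function_def
  proof (intro conjI ballI)
    have p0: "p d x = 0" if "d \<notin> range T" for d x
    proof -
      have "T -` {d} = {}" using that by auto
      then show ?thesis by (simp add: p_def)
    qed
    have "S ` space N \<subseteq> {f. \<forall>d. (d \<in> range T \<longrightarrow> f d \<in> {0..int m}) \<and> (d \<notin> range T \<longrightarrow> f d = 0)}"
    proof (intro image_subsetI CollectI allI conjI impI)
      fix x d assume x: "x \<in> space N"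
      have "0 \<le> real m * p d x" "real m * p d x \<le> real m"
        using p01(1)[of d x] p01(2)[OF x, of d] m0 by (auto simp: mult_left_le)
      then have "0 \<le> \<lfloor>real m * p d x\<rfloor>" "\<lfloor>real m * p d x\<rfloor> \<le> int m" by linarith+
      then show "S x d \<in> {0..int m}" by (simp add: S_def)
      show "S x d = 0" if "d \<notin> range T" using p0[OF that] by (simp add: S_def)
    qed
    then show "finite (S ` space N)"
      by (rule finite_subset) (intro finite_set_of_finite_funs fin; simp)
    fix s assume "s \<in> S ` space N"
    then have s0: "s d = 0" if "d \<notin> range T" for d using p0[OF that] by (auto simp: S_def)
    have "S -` {s} \<inter> space N = {x \<in> space N. \<forall>d\<in>range T. \<lfloor>real m * p d x\<rfloor> = s d}"
    proof safe
      fix x assume x: "x \<in> space N" "\<forall>d\<in>range T. \<lfloor>real m * p d x\<rfloor> = s d"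
      have "S x d = s d" for d
        using x(2) p0[of d x] s0[of d] by (cases "d \<in> range T") (auto simp: S_def)
      then show "x \<in> S -` {s}" by (auto simp: fun_eq_iff)
    qed (auto simp: S_def)
    also have "\<dots> \<in> sets N" using fin by measurable
    finally show "S -` {s} \<inter> space N \<in> sets N" .
  qed
  define g where "g x = ennreal (c x) + (\<integral>\<^sup>+y. ennreal (norm (y - T y)) \<partial>K x)" for x
  have [measurable]: "(\<lambda>x. \<integral>\<^sup>+y. ennreal (norm (y - T y)) \<partial>K x) \<in> borel_measurable N"
    by (rule measurable_compose[OF K' nn_integral_measurable_subprob_algebra]) measurable
  obtain \<rho> where \<rho>: "\<And>x. x \<in> space N \<Longrightarrow> \<rho> (S x) \<in> space N"
    and S\<rho>: "\<And>x. x \<in> space N \<Longrightarrow> S (\<rho> (S x)) = S x"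
    and g\<rho>: "\<And>x. x \<in> space N \<Longrightarrow> g (\<rho> (S x)) \<le> g x + ennreal e"
    using near_minimal_representative[OF \<open>0 < e\<close>, of "space N" S g] by metis
  define r where "r x = \<rho> (S x)" for x
  define I where "I = r ` space N"
  have rs: "simple_function N r"
    using simple_function_compose1[OF S, of \<rho>] by (simp add: r_def[abs_def])
  have I: "countable I" "I \<subseteq> space N"
    using simple_functionD(1)[OF rs] \<rho> by (auto simp: I_def r_def countable_finite)
  have rI[measurable]: "r \<in> N \<rightarrow>\<^sub>M count_space I"
    using simple_functionD[OF rs] by (subst measurable_count_space_eq2) (auto simp: I_def)
  have rN[measurable]: "r \<in> N \<rightarrow>\<^sub>M N"
    by (rule measurable_compose[OF rI]) (use I in auto)
  define \<nu>' where "\<nu>' = N \<bind> (\<lambda>x. K (r x))"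
  have Kr: "(\<lambda>x. K (r x)) \<in> N \<rightarrow>\<^sub>M prob_algebra borel"
    by (rule measurable_compose[OF rN K])
  note Kr' = measurable_prob_algebraD[OF Kr]
  have \<nu>': "\<nu>' \<in> space (prob_algebra borel)"
    unfolding \<nu>'_def by (rule bind_in_prob_algebra[OF N Kr])
  have "\<bar>measure \<nu>' (T -` {d}) - measure \<nu> (T -` {d})\<bar> \<le> 1 / m" for d
  proof -
    have int: "integrable N (p d)" "integrable N (\<lambda>x. p d (r x))"
      using p01 measurable_space[OF rN] by (auto intro!: integrable_const_bound[where B = 1])
    have "measure \<nu>' (T -` {d}) - measure \<nu> (T -` {d}) = (\<integral>x. p d (r x) - p d x \<partial>N)"
      unfolding \<nu>'_def \<nu>_def measure_bind[OF Kr' TB] measure_bind[OF K' TB] p_def[symmetric]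
      using int by simp
    also have "\<bar>\<dots>\<bar> \<le> (\<integral>x. \<bar>p d (r x) - p d x\<bar> \<partial>N)"
      by (rule integral_abs_bound)
    also have "\<dots> \<le> (\<integral>x. 1 / m \<partial>N)"
    proof (rule integral_mono)
      fix x assume "x \<in> space N"
      then have "\<lfloor>real m * p d (r x)\<rfloor> = \<lfloor>real m * p d x\<rfloor>"
        using S\<rho>[of x] by (auto simp: S_def r_def fun_eq_iff)
      then have "\<bar>real m * p d (r x) - real m * p d x\<bar> \<le> 1" by linarith
      then have "real m * \<bar>p d (r x) - p d x\<bar> \<le> 1"
        using m0 by (simp add: abs_mult flip: right_diff_distrib)
      then show "\<bar>p d (r x) - p d x\<bar> \<le> 1 / m" using m0 by (simp add: field_simps)
    qed (use int in auto)
    finally show ?thesis by (simp add: prob_space)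
  qed
  then have \<delta>: "(\<Sum>d\<in>range T. \<bar>measure \<nu>' (T -` {d}) - measure \<nu> (T -` {d})\<bar>) \<le> card (range T) * (1 / m)"
    by (intro sum_bounded_above)
  obtain k where k: "k \<in> borel_measurable (borel \<Otimes>\<^sub>M borel)"
    "AE y in \<nu>'. (\<integral>\<^sup>+z. k (y, z) \<partial>\<nu>) = 1" "AE z in \<nu>. (\<integral>\<^sup>+y. k (y, z) \<partial>\<nu>') = 1"
    and k_cost: "(\<integral>\<^sup>+y. (\<integral>\<^sup>+z. ennreal (norm (y - z)) * k (y, z) \<partial>\<nu>) \<partial>\<nu>')
      \<le> (\<integral>\<^sup>+y. ennreal (norm (y - T y)) \<partial>\<nu>') + (\<integral>\<^sup>+z. ennreal (norm (z - T z)) \<partial>\<nu>)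
        + ennreal (L * (card (range T) * (1 / m)))"
    using quantised_coupling_density[OF \<nu>' \<nu> T L \<delta>] by blast
  have small: "L * (card (range T) * (1 / m)) \<le> e"
    using m m0 \<open>0 < e\<close> by (simp add: field_simps)
  have T\<nu>': "(\<integral>\<^sup>+y. ennreal (norm (y - T y)) \<partial>\<nu>') = (\<integral>\<^sup>+x. (\<integral>\<^sup>+y. ennreal (norm (y - T y)) \<partial>K (r x)) \<partial>N)"
    unfolding \<nu>'_def by (rule nn_integral_bind[OF _ Kr']) measurable
  have T\<nu>2: "(\<integral>\<^sup>+y. ennreal (norm (y - T y)) \<partial>\<nu>) = (\<integral>\<^sup>+x. (\<integral>\<^sup>+y. ennreal (norm (y - T y)) \<partial>K x) \<partial>N)"
    unfolding \<nu>_def by (rule nn_integral_bind[OF _ K']) measurable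
  have "(\<integral>\<^sup>+x. ennreal (c (r x)) \<partial>N) + (\<integral>\<^sup>+y. ennreal (norm (y - T y)) \<partial>\<nu>') = (\<integral>\<^sup>+x. g (r x) \<partial>N)"
    unfolding g_def T\<nu>' by (rule nn_integral_add[symmetric]) measurable
  also have "\<dots> \<le> (\<integral>\<^sup>+x. g x + ennreal e \<partial>N)"
    unfolding r_def by (intro nn_integral_mono g\<rho>)
  also have "\<dots> = (\<integral>\<^sup>+x. ennreal (c x) \<partial>N) + (\<integral>\<^sup>+y. ennreal (norm (y - T y)) \<partial>\<nu>) + ennreal e"
    unfolding g_def T\<nu>2 by (simp add: nn_integral_add emeasure_space_1)
  also have "\<dots> \<le> (\<integral>\<^sup>+x. ennreal (c x) \<partial>N) + ennreal e + ennreal e"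
    by (intro add_mono T\<nu> order_refl)
  finally have total: "(\<integral>\<^sup>+x. ennreal (c (r x)) \<partial>N) + (\<integral>\<^sup>+y. ennreal (norm (y - T y)) \<partial>\<nu>')
      \<le> (\<integral>\<^sup>+x. ennreal (c x) \<partial>N) + ennreal e + ennreal e" .
  also have "\<dots> < \<infinity>" using cfin by (simp add: less_top)
  finally have "(\<integral>\<^sup>+x. ennreal (c (r x)) \<partial>N) < \<infinity>"
    by (simp add: less_top)
  then have "(\<integral>\<^sup>+x. ennreal (c (r x)) \<partial>N) < (\<integral>\<^sup>+x. ennreal (c (r x)) \<partial>N) + ennreal e"
    using \<open>0 < e\<close> by (simp add: ennreal_add_left_cancel_less)
  moreover have "W1 \<mu> \<nu>' \<le> (\<integral>\<^sup>+x. ennreal (c (r x)) \<partial>N)"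
    unfolding \<nu>'_def using I measurable_space[OF K] c
    by (intro W1_bind_countable[OF N rI _ \<mu>]) auto
  ultimately have "W1 \<mu> \<nu>' < (\<integral>\<^sup>+x. ennreal (c (r x)) \<partial>N) + ennreal e" by (rule le_less_trans[rotated])
  then obtain \<pi> where \<pi>: "\<pi> \<in> couplings \<mu> \<nu>'"
    and \<pi>_cost: "(\<integral>\<^sup>+z. ennreal (norm (fst z - snd z)) \<partial>\<pi>) < (\<integral>\<^sup>+x. ennreal (c (r x)) \<partial>N) + ennreal e"
    by (rule W1_lessE)
  have "W1 \<mu> \<nu> \<le> (\<integral>\<^sup>+w. ennreal (norm (fst w - snd w)) \<partial>\<pi>)
           + (\<integral>\<^sup>+y. (\<integral>\<^sup>+z. ennreal (norm (y - z)) * k (y, z) \<partial>\<nu>) \<partial>\<nu>')"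
    by (rule W1_triangle_density[OF \<pi> \<nu> k])
  also have "\<dots> \<le> ((\<integral>\<^sup>+x. ennreal (c (r x)) \<partial>N) + ennreal e)
      + ((\<integral>\<^sup>+y. ennreal (norm (y - T y)) \<partial>\<nu>') + ennreal e + ennreal e)"
    using small by (intro add_mono less_imp_le[OF \<pi>_cost] order_trans[OF k_cost] T\<nu> ennreal_leI order_refl)
  also have "\<dots> = ((\<integral>\<^sup>+x. ennreal (c (r x)) \<partial>N) + (\<integral>\<^sup>+y. ennreal (norm (y - T y)) \<partial>\<nu>'))
      + (ennreal e + ennreal e + ennreal e)"
    by (simp add: ac_simps)
  also have "\<dots> \<le> ((\<integral>\<^sup>+x. ennreal (c x) \<partial>N) + ennreal e + ennreal e) + (ennreal e + ennreal e + ennreal e)"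
    by (intro add_mono total order_refl)
  also have "\<dots> \<le> (\<integral>\<^sup>+x. ennreal (c x) \<partial>N) + ennreal e0"
    using \<open>0 < e\<close> by (simp add: add.assoc e_def flip: ennreal_plus)
  finally show "W1 \<mu> (N \<bind> K) \<le> (\<integral>\<^sup>+x. ennreal (c x) \<partial>N) + ennreal e0"
    unfolding \<nu>_def .
qed

section \<open>Moments of the invariant distribution\<close>

lemma powr_Lipschitz_on_bounded:
  fixes a b M q :: real
  assumes "1 \<le> q" "0 \<le> a" "a \<le> b" "b \<le> M"
  shows "b powr q - a powr q \<le> q * M powr (q - 1) * (b - a)"
proof (cases "a = b")
  case False
  then have "a < b" using assms by simp
  have cont: "continuous_on {a..b} (\<lambda>x. x powr q)"
    using assms by (intro continuous_on_powr' continuous_intros) auto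
  have deriv: "((\<lambda>x. x powr q) has_real_derivative q * x powr (q - 1)) (at x)" if "a < x" for x
    using that assms by (intro has_real_derivative_powr) simp
  obtain z where z: "a < z" "z < b" "b powr q - a powr q = (b - a) * (q * z powr (q - 1))"
    using MVT[OF \<open>a < b\<close> cont] deriv
    by (metis DERIV_unique real_differentiable_def)
  have "z powr (q - 1) \<le> M powr (q - 1)"
    using z assms by (intro powr_mono2) auto
  then have "(b - a) * (q * z powr (q - 1)) \<le> (b - a) * (q * M powr (q - 1))"
    using assms by (intro mult_left_mono) auto
  then show ?thesis using z(3) by (simp add: mult.commute mult.left_commute)
qed simp

lemma truncated_norm_powr_Lipschitz:
  fixes x y :: "'a::real_normed_vector"
  assumes "1 \<le> q" "0 \<le> M"
  shows "(min (norm y) M) powr q \<le> (min (norm x) M) powr q + q * M powr (q - 1) * norm (x - y)"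
proof (cases "norm x \<le> norm y")
  case True
  have "(min (norm y) M) powr q - (min (norm x) M) powr q
      \<le> q * M powr (q - 1) * (min (norm y) M - min (norm x) M)"
    using assms True by (intro powr_Lipschitz_on_bounded) auto
  also have "\<dots> \<le> q * M powr (q - 1) * norm (x - y)"
  proof (rule mult_left_mono)
    show "min (norm y) M - min (norm x) M \<le> norm (x - y)"
      using True norm_triangle_ineq2[of y x] norm_minus_commute[of x y] unfolding min_def
      by (smt (verit))
  qed (use assms in simp)
  finally show ?thesis by simp
next
  case False
  then have "(min (norm y) M) powr q \<le> (min (norm x) M) powr q"
    using assms by (intro powr_mono2) auto
  moreover have "0 \<le> q * M powr (q - 1) * norm (x - y)" using assms by simp
  ultimately show ?thesis by linarith
qed

text \<open>
  Otherwise the function would exceed a positive constant on a set of infinite measure.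
\<close>

lemma integrable_on_halfline_small:
  fixes e :: "real \<Rightarrow> real"
  assumes int: "set_integrable lebesgue {0..} e" and "0 < \<eta>"
  obtains t where "0 \<le> t" "e t \<le> \<eta>"
proof -
  have "\<exists>t\<ge>0. e t \<le> \<eta>"
  proof (rule ccontr)
    assume "\<not> ?thesis"
    then have gt: "\<eta> < e t" if "0 \<le> t" for t using that by force
    have "set_integrable lebesgue {0..} (\<lambda>_::real. \<eta>)"
    proof (rule set_integrable_bound[OF int])
      show "set_borel_measurable lebesgue {0..} (\<lambda>_::real. \<eta>)"
        unfolding set_borel_measurable_def
        by (intro borel_measurable_scaleR borel_measurable_indicator) auto
      show "AE t in lebesgue. t \<in> {0..} \<longrightarrow> norm \<eta> \<le> norm (e t)"
        using gt \<open>0 < \<eta>\<close> by (intro AE_I2) (force simp: abs_real_def)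
    qed
    then have "integrable lebesgue (\<lambda>t::real. indicator {0..} t :: real)"
      using \<open>0 < \<eta>\<close> by (simp add: set_integrable_def)
    then have "emeasure lebesgue {0::real..} < \<infinity>"
      by (simp add: integrable_indicator_iff)
    moreover have "emeasure lebesgue {0::real..} \<ge> ennreal (real n)" for n
    proof -
      have "ennreal (real n) = emeasure lebesgue {0..real n}" by simp
      also have "\<dots> \<le> emeasure lebesgue {0::real..}" by (intro emeasure_mono) auto
      finally show ?thesis .
    qed
    ultimately show False
      by (metis ennreal_Ex_less_of_nat ennreal_of_nat_eq_real_of_nat infinity_ennreal_def leD)
  qed
  then show thesis using that by blast
qed

text \<open>
  Testing with \<open>min(|y|, n)\<^sup>q\<close> instead of \<open>|y|\<^sup>q\<close> is what makes the Wasserstein bound applicable. Its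
  Lipschitz constant depends on \<open>n\<close>, but for each \<open>n\<close> there is a time at which \<open>e\<close> is small enough to
  compensate for it, while the bound \<open>C\<close> holds at all times.
\<close>

lemma invariant_moment_le:
  fixes P :: "real \<Rightarrow> 'a::euclidean_space \<Rightarrow> 'a measure" and \<Psi> :: "'a \<Rightarrow> 'a \<Rightarrow> real"
  assumes P: "\<And>t. 0 \<le> t \<Longrightarrow> P t \<in> borel \<rightarrow>\<^sub>M prob_algebra borel"
    and \<nu>: "invariant_distribution P \<nu>" and \<mu>: "\<mu> \<in> space (prob_algebra borel)"
    and \<Psi>[measurable]: "(\<lambda>(x, x'). \<Psi> x x') \<in> borel_measurable (borel \<Otimes>\<^sub>M borel)"
    and \<Psi>0: "\<And>x x'. 0 \<le> \<Psi> x x'"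
    and e: "set_integrable lebesgue {0..} e"
    and W: "\<And>t x x'. 0 \<le> t \<Longrightarrow> W1 (P t x) (P t x') \<le> ennreal (\<Psi> x x' * e t)"
    and fin: "(\<integral>\<^sup>+x. (\<integral>\<^sup>+x'. ennreal (\<Psi> x x') \<partial>\<nu>) \<partial>\<mu>) < \<infinity>"
    and q: "1 \<le> q"
    and C: "\<And>t. 0 \<le> t \<Longrightarrow> (\<integral>\<^sup>+y. ennreal (norm y powr q) \<partial>(\<mu> \<bind> P t)) \<le> C"
  shows "(\<integral>\<^sup>+y. ennreal (norm y powr q) \<partial>\<nu>) \<le> C"
proof -
  have sn[measurable_cong]: "sets \<nu> = sets borel" and pn: "prob_space \<nu>"
    and inv: "\<And>t. 0 \<le> t \<Longrightarrow> \<nu> \<bind> P t = \<nu>"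
    using \<nu> by (auto simp: invariant_distribution_def space_prob_algebra)
  have sm[measurable_cong]: "sets \<mu> = sets borel" and pm: "prob_space \<mu>"
    using \<mu> by (auto simp: space_prob_algebra)
  interpret N: prob_space \<nu> by (rule pn)
  interpret M: prob_space \<mu> by (rule pm)
  have P': "P t \<in> Q \<rightarrow>\<^sub>M subprob_algebra borel" if "0 \<le> t" "sets Q = sets borel" for t Q
    using measurable_prob_algebraD[OF P[OF that(1)]] that(2) by (simp cong: measurable_cong_sets)
  obtain A where A: "0 \<le> A" "(\<integral>\<^sup>+x. (\<integral>\<^sup>+x'. ennreal (\<Psi> x x') \<partial>\<nu>) \<partial>\<mu>) = ennreal A"
    using fin by (cases "\<integral>\<^sup>+x. (\<integral>\<^sup>+x'. ennreal (\<Psi> x x') \<partial>\<nu>) \<partial>\<mu>") auto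
  have trunc: "(\<integral>\<^sup>+y. ennreal ((min (norm y) (real n)) powr q) \<partial>\<nu>) \<le> C" for n :: nat
  proof (rule ennreal_le_epsilon)
    fix \<epsilon> :: real assume "0 < \<epsilon>"
    define f where "f y = ennreal ((min (norm y) (real n)) powr q)" for y :: 'a
    define L where "L = q * real n powr (q - 1)"
    have "0 \<le> L" using q by (simp add: L_def)
    have f[measurable]: "f \<in> borel_measurable borel" unfolding f_def by measurable
    have lip: "f y \<le> f x + ennreal L * ennreal (norm (x - y))" for x y
      using truncated_norm_powr_Lipschitz[OF q, of "real n" y x] \<open>0 \<le> L\<close>
      by (simp add: f_def L_def flip: ennreal_mult ennreal_plus)
    \<comment> \<open>At a time with \<open>e t \<le> \<eta>\<close> the total error is \<open>L (A + 1) \<eta>\<close>: \<open>A \<eta>\<close> bounds the averaged distance, a further \<open>\<eta>\<close> makes the inequality strict, and the last \<open>1\<close> keeps the denominator positive when \<open>L = 0\<close>.\<close>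
    define \<eta> where "\<eta> = \<epsilon> / (L * (A + 1) + 1)"
    have den: "0 < L * (A + 1) + 1" using \<open>0 \<le> L\<close> A(1) by (simp add: add_nonneg_pos)
    then have "0 < \<eta>" using \<open>0 < \<epsilon>\<close> by (simp add: \<eta>_def)
    obtain t where t: "0 \<le> t" "e t \<le> \<eta>"
      using integrable_on_halfline_small[OF e \<open>0 < \<eta>\<close>] .
    note [measurable] = P'[OF t(1) sn] P'[OF t(1) sm] P'[OF t(1) refl]
    have [measurable]: "(\<lambda>x. \<integral>\<^sup>+y. f y \<partial>P t x) \<in> borel_measurable borel"
      by (rule measurable_compose[OF P'[OF t(1) refl] nn_integral_measurable_subprob_algebra[OF f]])
    have step: "(\<integral>\<^sup>+y. f y \<partial>P t x') \<le> (\<integral>\<^sup>+y. f y \<partial>P t x) + ennreal L * (ennreal (\<Psi> x x') * ennreal \<eta> + ennreal \<eta>)" for x x'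
    proof (rule nn_integral_le_W1[OF f lip])
      have "W1 (P t x) (P t x') \<le> ennreal (\<Psi> x x' * \<eta>)"
        using W[OF t(1), of x x'] \<Psi>0[of x x'] t(2)
        by (elim order_trans) (intro ennreal_leI mult_left_mono)
      also have "\<dots> < ennreal (\<Psi> x x') * ennreal \<eta> + ennreal \<eta>"
        using \<Psi>0[of x x'] \<open>0 < \<eta>\<close> by (simp flip: ennreal_mult ennreal_plus add: ennreal_less_iff)
      finally show "W1 (P t x) (P t x') < ennreal (\<Psi> x x') * ennreal \<eta> + ennreal \<eta>" .
    qed
    have "(\<integral>\<^sup>+y. f y \<partial>\<nu>) = (\<integral>\<^sup>+x'. (\<integral>\<^sup>+y. f y \<partial>P t x') \<partial>\<nu>)"
      using nn_integral_bind[OF f P'[OF t(1) sn]] inv[OF t(1)] by simp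
    also have "\<dots> = (\<integral>\<^sup>+x. (\<integral>\<^sup>+x'. (\<integral>\<^sup>+y. f y \<partial>P t x') \<partial>\<nu>) \<partial>\<mu>)"
      by (simp add: M.emeasure_space_1)
    also have "\<dots> \<le> (\<integral>\<^sup>+x. (\<integral>\<^sup>+x'. (\<integral>\<^sup>+y. f y \<partial>P t x)
          + ennreal L * (ennreal (\<Psi> x x') * ennreal \<eta> + ennreal \<eta>) \<partial>\<nu>) \<partial>\<mu>)"
      by (intro nn_integral_mono step)
    also have "\<dots> = (\<integral>\<^sup>+x. (\<integral>\<^sup>+y. f y \<partial>P t x) \<partial>\<mu>) + ennreal L * (ennreal A * ennreal \<eta> + ennreal \<eta>)"
      unfolding A(2)[symmetric]
      by (simp add: nn_integral_add nn_integral_cmult nn_integral_multc N.emeasure_space_1 M.emeasure_space_1)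
    also have "(\<integral>\<^sup>+x. (\<integral>\<^sup>+y. f y \<partial>P t x) \<partial>\<mu>) = (\<integral>\<^sup>+y. f y \<partial>(\<mu> \<bind> P t))"
      using nn_integral_bind[OF f P'[OF t(1) sm]] by simp
    also have "\<dots> \<le> (\<integral>\<^sup>+y. ennreal (norm y powr q) \<partial>(\<mu> \<bind> P t))"
      unfolding f_def using q by (intro nn_integral_mono ennreal_leI powr_mono2) auto
    also have "\<dots> \<le> C" by (rule C[OF t(1)])
    also have "ennreal L * (ennreal A * ennreal \<eta> + ennreal \<eta>) = ennreal (L * (A + 1) * \<eta>)"
      using \<open>0 \<le> L\<close> A(1) \<open>0 < \<eta>\<close> by (simp flip: ennreal_mult ennreal_plus add: algebra_simps)
    also have "\<dots> \<le> ennreal \<epsilon>"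
    proof (rule ennreal_leI)
      have "L * (A + 1) * \<eta> \<le> (L * (A + 1) + 1) * \<eta>"
        using \<open>0 < \<eta>\<close> by (intro mult_right_mono) auto
      also have "\<dots> = \<epsilon>" using den by (simp add: \<eta>_def)
      finally show "L * (A + 1) * \<eta> \<le> \<epsilon>" .
    qed
    finally show "(\<integral>\<^sup>+y. ennreal ((min (norm y) (real n)) powr q) \<partial>\<nu>) \<le> C + ennreal \<epsilon>"
      by (simp add: f_def add_mono)
  qed
  have "(\<integral>\<^sup>+y. ennreal (norm y powr q) \<partial>\<nu>)
      = (\<integral>\<^sup>+y. liminf (\<lambda>n. ennreal ((min (norm y) (real n)) powr q)) \<partial>\<nu>)"
  proof (rule nn_integral_cong)
    fix y
    obtain m :: nat where "norm y \<le> real m" using real_arch_simple by blast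
    then have "\<forall>\<^sub>F n in sequentially. ennreal (norm y powr q) = ennreal ((min (norm y) (real n)) powr q)"
      by (intro eventually_sequentiallyI[of m]) (auto simp: min_def)
    then have "(\<lambda>n. ennreal ((min (norm y) (real n)) powr q)) \<longlonglongrightarrow> ennreal (norm y powr q)"
      by (rule tendsto_eventually[OF eventually_mono]) auto
    then show "ennreal (norm y powr q) = liminf (\<lambda>n. ennreal ((min (norm y) (real n)) powr q))"
      using lim_imp_Liminf[OF trivial_limit_sequentially] by metis
  qed
  also have "\<dots> \<le> liminf (\<lambda>n. \<integral>\<^sup>+y. ennreal ((min (norm y) (real n)) powr q) \<partial>\<nu>)"
    by (rule nn_integral_liminf) measurable
  also have "\<dots> \<le> C"
    using trunc by (intro Liminf_le) auto
  finally show ?thesis .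
qed

section \<open>Convergence to the invariant distribution\<close>

lemma le_one_plus_powr:
  fixes a q :: real
  assumes "0 \<le> a" "1 \<le> q"
  shows "a \<le> 1 + a powr q"
proof (cases "a \<le> 1")
  case False
  then have "a powr 1 \<le> a powr q" using assms by (intro powr_mono) auto
  then show ?thesis using False by simp
qed (simp add: add_increasing2)

theorem corollary2p8:
  fixes P :: "real \<Rightarrow> real ^ 'd \<Rightarrow> (real ^ 'd) measure"
    and \<nu> \<mu>0 :: "(real ^ 'd) measure"
    and \<Psi> :: "real ^ 'd \<Rightarrow> real ^ 'd \<Rightarrow> real"
    and \<psi> :: "real ^ 'd \<Rightarrow> real"
    and e :: "real \<Rightarrow> real"
    and q :: real
  assumes "markov_semigroup P"
    and "invariant_distribution P \<nu>"
    and "\<And>\<nu>'. invariant_distribution P \<nu>' \<Longrightarrow> \<nu>' = \<nu>"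
    and "(\<lambda>(x, x'). \<Psi> x x') \<in> borel_measurable (borel \<Otimes>\<^sub>M borel)"
    and "\<And>x x'. \<Psi> x x' \<ge> 0"
    and "set_integrable lebesgue {0..} e"
    and "\<And>t. t \<ge> 0 \<Longrightarrow> e t \<ge> 0"
    and "\<And>t x x'. t \<ge> 0 \<Longrightarrow> W1 (P t x) (P t x') \<le> ennreal (\<Psi> x x' * e t)"
    and "\<And>x. integrable \<nu> (\<Psi> x)"
    and "\<And>x. \<psi> x = (\<integral>x'. \<Psi> x x' \<partial>\<nu>)"
    and "q > 1"
    and "\<mu>0 \<in> finite_moment_measures q"
    and "(SUP t\<in>{0..}. \<integral>\<^sup>+y. ennreal (\<psi> y powr q + norm y powr q) \<partial>(\<mu>0 \<bind> P t)) < \<infinity>"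
  shows "(\<integral>\<^sup>+\<xi>. ennreal (norm \<xi> powr q) \<partial>\<nu>) < \<infinity> \<and>
    (\<forall>t\<ge>0. \<forall>x. W1 (P t x) \<nu> \<le> ennreal (\<psi> x * e t)) \<and>
    (SUP t\<in>{0..}. \<integral>\<^sup>+y. ennreal (\<psi> y powr q + norm y powr q) \<partial>(\<mu>0 \<bind> P t)) < \<infinity>"
proof (intro conjI allI impI)
  note \<Psi>[measurable] = assms(4) and \<Psi>0 = assms(5) and e0 = assms(7) and q = assms(11) and sup = assms(13)
  define C where "C = (SUP t\<in>{0..}. \<integral>\<^sup>+y. ennreal (\<psi> y powr q + norm y powr q) \<partial>(\<mu>0 \<bind> P t))"
  have P: "P t \<in> borel \<rightarrow>\<^sub>M prob_algebra borel" if "0 \<le> t" for t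
    using assms(1) that by (auto simp: markov_semigroup_def)
  have sn[measurable_cong]: "sets \<nu> = sets borel" and pn: "prob_space \<nu>"
    and inv: "\<And>t. 0 \<le> t \<Longrightarrow> \<nu> \<bind> P t = \<nu>"
    using assms(2) by (auto simp: invariant_distribution_def space_prob_algebra)
  interpret N: prob_space \<nu> by (rule pn)
  have \<mu>: "\<mu>0 \<in> space (prob_algebra borel)" using assms(12) by (simp add: finite_moment_measures_def)
  then have sm[measurable_cong]: "sets \<mu>0 = sets borel" and pm: "prob_space \<mu>0"
    by (auto simp: space_prob_algebra)
  interpret M: prob_space \<mu>0 by (rule pm)
  have \<psi>_eq: "(\<integral>\<^sup>+x'. ennreal (\<Psi> x x') \<partial>\<nu>) = ennreal (\<psi> x)" for x
    unfolding assms(10) using \<Psi>0 by (intro nn_integral_eq_integral assms(9)) auto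
  have \<psi>0: "0 \<le> \<psi> x" for x unfolding assms(10) using \<Psi>0 by (intro Bochner_Integration.integral_nonneg) auto
  have [measurable]: "\<psi> \<in> borel_measurable borel"
    unfolding assms(10)[abs_def] by measurable
  have bind_le: "(\<integral>\<^sup>+y. ennreal (\<psi> y powr q + norm y powr q) \<partial>(\<mu>0 \<bind> P t)) \<le> C" if "0 \<le> t" for t
    unfolding C_def using that by (intro SUP_upper) auto
  \<comment> \<open>At time \<open>0\<close> the moment bound is one on \<open>\<mu>0\<close> itself, which makes \<open>\<psi>\<close> integrable under \<open>\<mu>0\<close>.\<close>
  have "P 0 = return borel" using assms(1) by (auto simp: markov_semigroup_def)
  also have "return borel = return \<mu>0" by (rule return_sets_cong) (simp add: sm)
  finally have \<mu>0_bind: "\<mu>0 \<bind> P 0 = \<mu>0" by (simp add: bind_return')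
  have "(\<integral>\<^sup>+x. ennreal (\<psi> x) \<partial>\<mu>0) \<le> (\<integral>\<^sup>+x. 1 + ennreal (\<psi> x powr q + norm x powr q) \<partial>\<mu>0)"
  proof (rule nn_integral_mono)
    fix x
    have "\<psi> x \<le> 1 + (\<psi> x powr q + norm x powr q)"
      using le_one_plus_powr[OF \<psi>0, of q x] q powr_ge_zero[of "norm x" q] by linarith
    then show "ennreal (\<psi> x) \<le> 1 + ennreal (\<psi> x powr q + norm x powr q)"
      by (simp flip: ennreal_1 ennreal_plus)
  qed
  also have "\<dots> = 1 + (\<integral>\<^sup>+x. ennreal (\<psi> x powr q + norm x powr q) \<partial>(\<mu>0 \<bind> P 0))"
    unfolding \<mu>0_bind by (subst nn_integral_add) (auto simp: M.emeasure_space_1)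
  also have "\<dots> \<le> 1 + C" by (intro add_left_mono bind_le) simp
  also have "\<dots> < \<infinity>" using sup by (simp add: C_def less_top)
  finally have fin: "(\<integral>\<^sup>+x. ennreal (\<psi> x) \<partial>\<mu>0) < \<infinity>" .
  have "(\<integral>\<^sup>+\<xi>. ennreal (norm \<xi> powr q) \<partial>\<nu>) \<le> C"
  proof (rule invariant_moment_le[OF P assms(2) \<mu> \<Psi> \<Psi>0 assms(6) assms(8)])
    show "(\<integral>\<^sup>+x. (\<integral>\<^sup>+x'. ennreal (\<Psi> x x') \<partial>\<nu>) \<partial>\<mu>0) < \<infinity>" using fin by (simp add: \<psi>_eq)
    fix t :: real assume t: "0 \<le> t"
    show "(\<integral>\<^sup>+y. ennreal (norm y powr q) \<partial>(\<mu>0 \<bind> P t)) \<le> C"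
      by (rule order_trans[OF _ bind_le[OF t]]) (intro nn_integral_mono ennreal_leI, simp)
  qed (use q in auto)
  also have "C < \<infinity>" using sup by (simp add: C_def)
  finally show mq: "(\<integral>\<^sup>+\<xi>. ennreal (norm \<xi> powr q) \<partial>\<nu>) < \<infinity>" .
  show "(SUP t\<in>{0..}. \<integral>\<^sup>+y. ennreal (\<psi> y powr q + norm y powr q) \<partial>(\<mu>0 \<bind> P t)) < \<infinity>" by (rule sup)
  have "(\<integral>\<^sup>+y. ennreal (norm y) \<partial>\<nu>) \<le> (\<integral>\<^sup>+y. 1 + ennreal (norm y powr q) \<partial>\<nu>)"
    using le_one_plus_powr q by (intro nn_integral_mono) (simp flip: ennreal_1 ennreal_plus)
  also have "\<dots> < \<infinity>" using mq by (subst nn_integral_add) (auto simp: N.emeasure_space_1 less_top)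
  finally have m1: "(\<integral>\<^sup>+y. ennreal (norm y) \<partial>\<nu>) < \<infinity>" .
  fix t :: real and x assume t: "0 \<le> t"
  have "P t \<in> \<nu> \<rightarrow>\<^sub>M prob_algebra borel" using P[OF t] by (simp add: sn cong: measurable_cong_sets)
  moreover have "P t x \<in> space (prob_algebra borel)" using measurable_space[OF P[OF t]] by simp
  ultimately have "W1 (P t x) (\<nu> \<bind> P t) \<le> (\<integral>\<^sup>+x'. ennreal (\<Psi> x x' * e t) \<partial>\<nu>)"
    using m1 assms(8)[OF t] by (intro W1_bind_le[OF pn]) (auto simp: inv[OF t])
  also have "\<dots> = ennreal (\<psi> x * e t)"
    using \<Psi>0 e0[OF t] \<psi>0 by (simp add: ennreal_mult nn_integral_multc \<psi>_eq)
  finally show "W1 (P t x) \<nu> \<le> ennreal (\<psi> x * e t)" by (simp add: inv[OF t])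
qed

end
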